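(* Let $\mathbf{A}$ be a Heyting algebra, $\mathbf{B}=s(\mathbf{A})$, $\nabla$ a filter of $\mathbf{A}$ containing all dense elements of $\mathbf{A}$, $\Delta$ an ideal of $\mathbf{A}$, and $\mathbf{T}=Tw(\mathbf{B},\rho(\nabla),\sigma(\Delta))$. Then for every formula $\varphi$ of the language $\{\wedge,\vee,\to,\bot,\sim\}$: $$\mathbf{T}\models\mathrm{T}_{\mathbf{B}}\varphi\iff Tw(\mathbf{A},\nabla,N(\Delta))\models\varphi.$$
   Context: A topological Boolean algebra (TBA) is an algebra $\langle B;\vee,\wedge,\to,\bot,\Box\rangle$ whose reduct is a Boolean algebra ($\neg_{\mathbf{B}}a:=a\to\bot$) with $\Box 1=1$, $\Box(a\wedge b)=\Box a\wedge\Box b$, $\Box a\le a$, $\Box a\le\Box\Box a$; $\Diamond a:=\neg_{\mathbf{B}}\Box\neg_{\mathbf{B}}a$. Its open elements $\{a:\Box a=a\}$ form a Heyting algebra $\mathcal{G}(\mathbf{B})$ with $\vee,\wedge,\bot$ of $\mathbf{B}$ and implication $\Box(a\to b)$. For a Heyting algebra $\mathbf{A}$, $s(\mathbf{A})$ is the TBA $\mathbf{B}$ (unique up to isomorphism) with $\mathcal{G}(\mathbf{B})=\mathbf{A}$ and generated by its open elements. In $\mathbf{A}$, $\neg a:=a\to\bot$; $a$ is dense if $\neg a=\bot$. $\rho(\nabla)=\{x\in B:\Box x\in\nabla\}$; $\sigma(\Delta)=\{x\in B:x\le\Diamond y\text{ for some }y\in\Delta\}$; $N(\Delta)=\{a\in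 A:a\le\neg\neg b\text{ for some }b\in\Delta\}$. Full twist-structure $\mathbf{C}^{\bowtie}$ over a Heyting algebra or TBA $\mathbf{C}$: universe $C\times C$, $(a,b)\vee(c,d)=(a\vee c,b\wedge d)$, $(a,b)\wedge(c,d)=(a\wedge c,b\vee d)$, $(a,b)\to(c,d)=(a\to c,a\wedge d)$, $\bot=(\bot,1)$, $\sim(a,b)=(b,a)$, and for a TBA $\Box(a,b)=(\Box a,\Diamond b)$, $\Diamond(a,b)=(\Diamond a,\Box b)$. $Tw(\mathbf{C},\nabla',\Delta')$ is the subalgebra of $\mathbf{C}^{\bowtie}$ on $\{(a,b):a\vee b\in\nabla',\ a\wedge b\in\Delta'\}$. Validity: $\mathcal{A}\models\varphi$ iff $\pi_1(v(\varphi))=1$ for every homomorphism $v$ from the formula algebra into $\mathcal{A}$. Translation $\mathrm{T}_{\mathbf{B}}$: $\mathrm{T}_{\mathbf{B}}(p)=\Box p$, $\mathrm{T}_{\mathbf{B}}(\sim p)=\Box\sim p$, $\mathrm{T}_{\mathbf{B}}(\bot)=\bot$, $\mathrm{T}_{\mathbf{B}}(\sim\bot)=\sim\bot$, $\mathrm{T}_{\mathbf{B}}(\varphi\wedge\psi)=\mathrm{T}_{\mathbf{B}}\varphi\wedge\mathrm{T}_{\mathbf{B}}\psi$, $\mathrm{T}_{\mathbf{B}}(\varphi\vee\psi)=\mathrm{T}_{\mathbf{B}}\varphi\vee\mathrm{T}_{\mathbf{B}}\psi$, $\mathrm{T}_{\mathbf{B}}(\varphi\to\psi)=\Box(\mathrm{T}_{\mathbf{B}}\varphi\to\mathrm{T}_{\mathbf{B}}\psi)$,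 $\mathrm{T}_{\mathbf{B}}(\sim(\varphi\wedge\psi))=\mathrm{T}_{\mathbf{B}}(\sim\varphi)\vee\mathrm{T}_{\mathbf{B}}(\sim\psi)$, $\mathrm{T}_{\mathbf{B}}(\sim(\varphi\vee\psi))=\mathrm{T}_{\mathbf{B}}(\sim\varphi)\wedge\mathrm{T}_{\mathbf{B}}(\sim\psi)$, $\mathrm{T}_{\mathbf{B}}(\sim(\varphi\to\psi))=\mathrm{T}_{\mathbf{B}}\varphi\wedge\mathrm{T}_{\mathbf{B}}(\sim\psi)$, $\mathrm{T}_{\mathbf{B}}(\sim\sim\varphi)=\mathrm{T}_{\mathbf{B}}\varphi$. *)

theory Defs
  imports Main
begin

section \<open>Heyting algebras and topological Boolean algebras\<close>

record 'a halg =
  carrier :: "'a set"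
  join :: "'a \<Rightarrow> 'a \<Rightarrow> 'a"
  meet :: "'a \<Rightarrow> 'a \<Rightarrow> 'a"
  imp :: "'a \<Rightarrow> 'a \<Rightarrow> 'a"
  bot :: "'a"

record 'a talg = "'a halg" +
  box :: "'a \<Rightarrow> 'a"

definition le :: "('a, 'm) halg_scheme \<Rightarrow> 'a \<Rightarrow> 'a \<Rightarrow> bool" where
  "le A a b \<longleftrightarrow> meet A a b = a"

definition neg :: "('a, 'm) halg_scheme \<Rightarrow> 'a \<Rightarrow> 'a" where
  "neg A a = imp A a (bot A)"

text \<open>The signature has no constant for the greatest element.\<close>

definition one :: "('a, 'm) halg_scheme \<Rightarrow> 'a" where
  "one A = imp A (bot A) (bot A)"

locale lattice_with_bot =
  fixes A :: "('a, 'm) halg_scheme"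
  assumes join_closed: "\<lbrakk>a \<in> carrier A; b \<in> carrier A\<rbrakk> \<Longrightarrow> join A a b \<in> carrier A"
    and meet_closed: "\<lbrakk>a \<in> carrier A; b \<in> carrier A\<rbrakk> \<Longrightarrow> meet A a b \<in> carrier A"
    and imp_closed: "\<lbrakk>a \<in> carrier A; b \<in> carrier A\<rbrakk> \<Longrightarrow> imp A a b \<in> carrier A"
    and bot_closed: "bot A \<in> carrier A"
    and join_comm: "\<lbrakk>a \<in> carrier A; b \<in> carrier A\<rbrakk> \<Longrightarrow> join A a b = join A b a"
    and meet_comm: "\<lbrakk>a \<in> carrier A; b \<in> carrier A\<rbrakk> \<Longrightarrow> meet A a b = meet A b a"
    and join_assoc: "\<lbrakk>a \<in> carrier A; b \<in> carrier A; c \<in> carrier A\<rbrakk>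
      \<Longrightarrow> join A (join A a b) c = join A a (join A b c)"
    and meet_assoc: "\<lbrakk>a \<in> carrier A; b \<in> carrier A; c \<in> carrier A\<rbrakk>
      \<Longrightarrow> meet A (meet A a b) c = meet A a (meet A b c)"
    and join_absorb: "\<lbrakk>a \<in> carrier A; b \<in> carrier A\<rbrakk> \<Longrightarrow> join A a (meet A a b) = a"
    and meet_absorb: "\<lbrakk>a \<in> carrier A; b \<in> carrier A\<rbrakk> \<Longrightarrow> meet A a (join A a b) = a"
    and bot_least: "a \<in> carrier A \<Longrightarrow> le A (bot A) a"

locale heyting_algebra = lattice_with_bot +
  assumes residuation: "\<lbrakk>a \<in> carrier A; b \<in> carrier A; c \<in> carrier A\<rbrakk>
      \<Longrightarrow> le A (meet A a b) c \<longleftrightarrow> le A a (imp A b c)"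

locale boolean_algebra_on = lattice_with_bot +
  assumes distrib: "\<lbrakk>a \<in> carrier A; b \<in> carrier A; c \<in> carrier A\<rbrakk>
      \<Longrightarrow> meet A a (join A b c) = join A (meet A a b) (meet A a c)"
    and one_greatest: "a \<in> carrier A \<Longrightarrow> le A a (one A)"
    and meet_neg: "a \<in> carrier A \<Longrightarrow> meet A a (neg A a) = bot A"
    and join_neg: "a \<in> carrier A \<Longrightarrow> join A a (neg A a) = one A"
    and imp_eq: "\<lbrakk>a \<in> carrier A; b \<in> carrier A\<rbrakk> \<Longrightarrow> imp A a b = join A (neg A a) b"

locale topological_boolean_algebra = boolean_algebra_on B
  for B :: "('b, 'm) talg_scheme" +
  assumes box_closed: "a \<in> carrier B \<Longrightarrow> box B a \<in> carrier B"
    and box_one: "box B (one B) = one B"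
    and box_meet: "\<lbrakk>a \<in> carrier B; b \<in> carrier B\<rbrakk>
      \<Longrightarrow> box B (meet B a b) = meet B (box B a) (box B b)"
    and box_le: "a \<in> carrier B \<Longrightarrow> le B (box B a) a"
    and box_le_box_box: "a \<in> carrier B \<Longrightarrow> le B (box B a) (box B (box B a))"

definition dia :: "('b, 'm) talg_scheme \<Rightarrow> 'b \<Rightarrow> 'b" where
  "dia B a = neg B (box B (neg B a))"

section \<open>Open elements and the algebra s(A)\<close>

definition open_algebra :: "('b, 'm) talg_scheme \<Rightarrow> 'b halg" where
  "open_algebra B =
    \<lparr>carrier = {a \<in> carrier B. box B a = a},
     join = join B, meet = meet B, imp = (\<lambda>a b. box B (imp B a b)), bot = bot B\<rparr>"

definition halg_iso :: "('a \<Rightarrow> 'b) \<Rightarrow> ('a, 'm) halg_scheme \<Rightarrow> ('b, 'n) halg_scheme \<Rightarrow> bool" where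
  "halg_iso e A A' \<longleftrightarrow>
    bij_betw e (carrier A) (carrier A') \<and>
    (\<forall>a\<in>carrier A. \<forall>b\<in>carrier A.
       e (join A a b) = join A' (e a) (e b) \<and>
       e (meet A a b) = meet A' (e a) (e b) \<and>
       e (imp A a b) = imp A' (e a) (e b)) \<and>
    e (bot A) = bot A'"

definition subuniverse :: "('b, 'm) talg_scheme \<Rightarrow> 'b set \<Rightarrow> bool" where
  "subuniverse B S \<longleftrightarrow>
    S \<subseteq> carrier B \<and> bot B \<in> S \<and>
    (\<forall>a\<in>S. \<forall>b\<in>S. join B a b \<in> S \<and> meet B a b \<in> S \<and> imp B a b \<in> S) \<and>
    (\<forall>a\<in>S. box B a \<in> S)"

definition generated_by :: "('b, 'm) talg_scheme \<Rightarrow> 'b set \<Rightarrow> bool" where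
  "generated_by B X \<longleftrightarrow> (\<forall>S. subuniverse B S \<and> X \<subseteq> S \<longrightarrow> S = carrier B)"

text \<open>The algebra s(A) is determined only up to isomorphism, and it usually does not fit
  into the type of A.  Hence it is a predicate, and the identification of A with the
  algebra of open elements of B is an explicit isomorphism e (the identity if the two
  algebras are literally equal).\<close>

definition is_s :: "('a, 'm) halg_scheme \<Rightarrow> ('a \<Rightarrow> 'b) \<Rightarrow> ('b, 'n) talg_scheme \<Rightarrow> bool" where
  "is_s A e B \<longleftrightarrow>
    topological_boolean_algebra B \<and>
    halg_iso e A (open_algebra B) \<and>
    generated_by B (carrier (open_algebra B))"

section \<open>Filters and ideals\<close>

definition lfilter :: "('a, 'm) halg_scheme \<Rightarrow> 'a set \<Rightarrow> bool" where
  "lfilter A F \<longleftrightarrow>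
    F \<subseteq> carrier A \<and> F \<noteq> {} \<and>
    (\<forall>a\<in>F. \<forall>b\<in>F. meet A a b \<in> F) \<and>
    (\<forall>a\<in>F. \<forall>b\<in>carrier A. le A a b \<longrightarrow> b \<in> F)"

definition lideal :: "('a, 'm) halg_scheme \<Rightarrow> 'a set \<Rightarrow> bool" where
  "lideal A I \<longleftrightarrow>
    I \<subseteq> carrier A \<and> I \<noteq> {} \<and>
    (\<forall>a\<in>I. \<forall>b\<in>I. join A a b \<in> I) \<and>
    (\<forall>a\<in>I. \<forall>b\<in>carrier A. le A b a \<longrightarrow> b \<in> I)"

definition dense :: "('a, 'm) halg_scheme \<Rightarrow> 'a \<Rightarrow> bool" where
  "dense A a \<longleftrightarrow> a \<in> carrier A \<and> neg A a = bot A"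

definition rho :: "('b, 'm) talg_scheme \<Rightarrow> 'b set \<Rightarrow> 'b set" where
  "rho B F = {x \<in> carrier B. box B x \<in> F}"

definition sigma :: "('b, 'm) talg_scheme \<Rightarrow> 'b set \<Rightarrow> 'b set" where
  "sigma B I = {x \<in> carrier B. \<exists>y\<in>I. le B x (dia B y)}"

definition N :: "('a, 'm) halg_scheme \<Rightarrow> 'a set \<Rightarrow> 'a set" where
  "N A I = {a \<in> carrier A. \<exists>b\<in>I. le A a (neg A (neg A b))}"

section \<open>Twist-structures\<close>

record 'a nalg = "'a halg" +
  sneg :: "'a \<Rightarrow> 'a"

record 'a mnalg = "'a nalg" +
  mbox :: "'a \<Rightarrow> 'a"
  mdia :: "'a \<Rightarrow> 'a"

definition full_twist :: "('c, 'm) halg_scheme \<Rightarrow> ('c \<times> 'c) nalg" where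
  "full_twist C =
    \<lparr>carrier = carrier C \<times> carrier C,
     join = (\<lambda>(a, b) (c, d). (join C a c, meet C b d)),
     meet = (\<lambda>(a, b) (c, d). (meet C a c, join C b d)),
     imp = (\<lambda>(a, b) (c, d). (imp C a c, meet C a d)),
     bot = (bot C, one C),
     sneg = (\<lambda>(a, b). (b, a))\<rparr>"

definition full_mtwist :: "('c, 'm) talg_scheme \<Rightarrow> ('c \<times> 'c) mnalg" where
  "full_mtwist C =
    nalg.extend (full_twist C)
      (mnalg.fields (\<lambda>(a, b). (box C a, dia C b)) (\<lambda>(a, b). (dia C a, box C b)))"

definition twist_univ :: "('c, 'm) halg_scheme \<Rightarrow> 'c set \<Rightarrow> 'c set \<Rightarrow> ('c \<times> 'c) set" where
  "twist_univ C F I =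
    {(a, b). a \<in> carrier C \<and> b \<in> carrier C \<and> join C a b \<in> F \<and> meet C a b \<in> I}"

definition Tw :: "('c, 'm) halg_scheme \<Rightarrow> 'c set \<Rightarrow> 'c set \<Rightarrow> ('c \<times> 'c) nalg" where
  "Tw C F I = (full_twist C)\<lparr>carrier := twist_univ C F I\<rparr>"

definition mTw :: "('c, 'm) talg_scheme \<Rightarrow> 'c set \<Rightarrow> 'c set \<Rightarrow> ('c \<times> 'c) mnalg" where
  "mTw C F I = (full_mtwist C)\<lparr>carrier := twist_univ C F I\<rparr>"

section \<open>Formulas, validity and the translation\<close>

datatype 'p fm =
    Var 'p | Bot | And "'p fm" "'p fm" | Or "'p fm" "'p fm" | Imp "'p fm" "'p fm"
  | SNeg "'p fm"

datatype 'p mfm =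
    MVar 'p | MBot | MAnd "'p mfm" "'p mfm" | MOr "'p mfm" "'p mfm" | MImp "'p mfm" "'p mfm"
  | MSNeg "'p mfm" | MBox "'p mfm" | MDia "'p mfm"

definition fm_hom :: "('p fm \<Rightarrow> 'a) \<Rightarrow> ('a, 'm) nalg_scheme \<Rightarrow> bool" where
  "fm_hom v T \<longleftrightarrow>
    (\<forall>\<phi>. v \<phi> \<in> carrier T) \<and>
    v Bot = bot T \<and>
    (\<forall>\<phi> \<psi>. v (And \<phi> \<psi>) = meet T (v \<phi>) (v \<psi>)) \<and>
    (\<forall>\<phi> \<psi>. v (Or \<phi> \<psi>) = join T (v \<phi>) (v \<psi>)) \<and>
    (\<forall>\<phi> \<psi>. v (Imp \<phi> \<psi>) = imp T (v \<phi>) (v \<psi>)) \<and>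
    (\<forall>\<phi>. v (SNeg \<phi>) = sneg T (v \<phi>))"

definition mfm_hom :: "('p mfm \<Rightarrow> 'a) \<Rightarrow> ('a, 'm) mnalg_scheme \<Rightarrow> bool" where
  "mfm_hom v T \<longleftrightarrow>
    (\<forall>\<phi>. v \<phi> \<in> carrier T) \<and>
    v MBot = bot T \<and>
    (\<forall>\<phi> \<psi>. v (MAnd \<phi> \<psi>) = meet T (v \<phi>) (v \<psi>)) \<and>
    (\<forall>\<phi> \<psi>. v (MOr \<phi> \<psi>) = join T (v \<phi>) (v \<psi>)) \<and>
    (\<forall>\<phi> \<psi>. v (MImp \<phi> \<psi>) = imp T (v \<phi>) (v \<psi>)) \<and>
    (\<forall>\<phi>. v (MSNeg \<phi>) = sneg T (v \<phi>)) \<and>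
    (\<forall>\<phi>. v (MBox \<phi>) = mbox T (v \<phi>)) \<and>
    (\<forall>\<phi>. v (MDia \<phi>) = mdia T (v \<phi>))"

text \<open>Validity in a twist-structure T over C; the argument C supplies the element 1 with
  which the first component is compared.\<close>

definition valid ::
    "('c, 'm) halg_scheme \<Rightarrow> ('c \<times> 'c, 'n) nalg_scheme \<Rightarrow> 'p fm \<Rightarrow> bool" where
  "valid C T \<phi> \<longleftrightarrow> (\<forall>v. fm_hom v T \<longrightarrow> fst (v \<phi>) = one C)"

definition mvalid ::
    "('c, 'm) talg_scheme \<Rightarrow> ('c \<times> 'c, 'n) mnalg_scheme \<Rightarrow> 'p mfm \<Rightarrow> bool" where
  "mvalid C T \<phi> \<longleftrightarrow> (\<forall>v. mfm_hom v T \<longrightarrow> fst (v \<phi>) = one C)"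

fun TB :: "'p fm \<Rightarrow> 'p mfm" where
  "TB (Var p) = MBox (MVar p)"
| "TB Bot = MBot"
| "TB (And \<phi> \<psi>) = MAnd (TB \<phi>) (TB \<psi>)"
| "TB (Or \<phi> \<psi>) = MOr (TB \<phi>) (TB \<psi>)"
| "TB (Imp \<phi> \<psi>) = MBox (MImp (TB \<phi>) (TB \<psi>))"
| "TB (SNeg (Var p)) = MBox (MSNeg (MVar p))"
| "TB (SNeg Bot) = MSNeg MBot"
| "TB (SNeg (And \<phi> \<psi>)) = MOr (TB (SNeg \<phi>)) (TB (SNeg \<psi>))"
| "TB (SNeg (Or \<phi> \<psi>)) = MAnd (TB (SNeg \<phi>)) (TB (SNeg \<psi>))"
| "TB (SNeg (Imp \<phi> \<psi>)) = MAnd (TB \<phi>) (TB (SNeg \<psi>))"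
| "TB (SNeg (SNeg \<phi>)) = TB \<phi>"

end

theory Submission
  imports Defs
begin

text \<open>Both twist-structures are evaluated on variables by pairs, and the first component of the
  value of a formula depends only on first components once negation is pushed to the variables.
  Hence a valuation \<open>p \<mapsto> (a, b)\<close> into the twist-structure over \<open>A\<close> is also one into the
  twist-structure over \<open>B\<close>, because \<open>\<not>\<not>d = \<box>\<diamond>d \<le> \<diamond>d\<close>; conversely \<open>p \<mapsto> (x, y)\<close> is sent to
  \<open>p \<mapsto> (\<box>x, \<box>y)\<close>. The only delicate point is \<open>\<box>x \<or> \<box>y \<in> \<nabla>\<close> when \<open>\<box>(x \<or> y) \<in> \<nabla>\<close>. The
  elements \<open>x\<close> with \<open>\<box>x \<or> \<box>\<not>x \<in> \<nabla>\<close> form a subalgebra containing all open elements, since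
  \<open>a \<or> \<not>a\<close> is dense; as \<open>B\<close> is generated by its open elements, this subalgebra is \<open>B\<close>, and
  \<open>\<box>(x \<or> y) \<and> (\<box>x \<or> \<box>\<not>x) \<le> \<box>x \<or> \<box>y\<close>.\<close>

section \<open>Order in Heyting and Boolean algebras\<close>

context lattice_with_bot
begin

lemmas closed [simp, intro] = join_closed meet_closed imp_closed bot_closed

lemma neg_closed [simp, intro]: "a \<in> carrier A \<Longrightarrow> neg A a \<in> carrier A"
  by (simp add: neg_def)

lemma one_closed [simp, intro]: "one A \<in> carrier A"
  by (simp add: one_def)

lemma meet_idem [simp]: "a \<in> carrier A \<Longrightarrow> meet A a a = a"
  by (metis join_absorb meet_absorb meet_closed)

lemma le_refl [simp]: "a \<in> carrier A \<Longrightarrow> le A a a"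
  by (simp add: le_def)

lemma le_antisym:
  "\<lbrakk>le A a b; le A b a; a \<in> carrier A; b \<in> carrier A\<rbrakk> \<Longrightarrow> a = b"
  by (metis le_def meet_comm)

lemma le_trans:
  "\<lbrakk>le A a b; le A b c; a \<in> carrier A; b \<in> carrier A; c \<in> carrier A\<rbrakk> \<Longrightarrow> le A a c"
  unfolding le_def using meet_assoc[of a b c] by simp

lemma meet_le1: "\<lbrakk>a \<in> carrier A; b \<in> carrier A\<rbrakk> \<Longrightarrow> le A (meet A a b) a"
  unfolding le_def using meet_assoc[of a a b] meet_comm[of "meet A a b" a] by simp

lemma meet_le2: "\<lbrakk>a \<in> carrier A; b \<in> carrier A\<rbrakk> \<Longrightarrow> le A (meet A a b) b"
  using meet_le1[of b a] by (simp add: meet_comm)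

lemma le_meet:
  "\<lbrakk>le A c a; le A c b; a \<in> carrier A; b \<in> carrier A; c \<in> carrier A\<rbrakk> \<Longrightarrow> le A c (meet A a b)"
  unfolding le_def using meet_assoc[of c a b] by simp

lemma le_join1: "\<lbrakk>a \<in> carrier A; b \<in> carrier A\<rbrakk> \<Longrightarrow> le A a (join A a b)"
  by (simp add: le_def meet_absorb)

lemma le_join2: "\<lbrakk>a \<in> carrier A; b \<in> carrier A\<rbrakk> \<Longrightarrow> le A b (join A a b)"
  using le_join1[of b a] by (simp add: join_comm)

lemma le_iff_join:
  "\<lbrakk>a \<in> carrier A; b \<in> carrier A\<rbrakk> \<Longrightarrow> le A a b \<longleftrightarrow> join A a b = b"
  unfolding le_def using join_absorb[of b a] meet_absorb[of a b] join_comm[of a b] meet_comm[of a b]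
  by auto

lemma join_le:
  "\<lbrakk>le A a c; le A b c; a \<in> carrier A; b \<in> carrier A; c \<in> carrier A\<rbrakk> \<Longrightarrow> le A (join A a b) c"
  using join_assoc[of a b c] by (simp add: le_iff_join)

lemma le_join_mono:
  "\<lbrakk>le A a b \<or> le A a c; a \<in> carrier A; b \<in> carrier A; c \<in> carrier A\<rbrakk> \<Longrightarrow> le A a (join A b c)"
  using le_trans[OF _ le_join1[of b c]] le_trans[OF _ le_join2[of b c]] by auto

lemma meet_le_mono:
  "\<lbrakk>le A a c \<or> le A b c; a \<in> carrier A; b \<in> carrier A; c \<in> carrier A\<rbrakk> \<Longrightarrow> le A (meet A a b) c"
  using le_trans[OF meet_le1[of a b]] le_trans[OF meet_le2[of a b]] by auto

lemma meet_mono: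
  "\<lbrakk>le A a b; le A c d; a \<in> carrier A; b \<in> carrier A; c \<in> carrier A; d \<in> carrier A\<rbrakk>
    \<Longrightarrow> le A (meet A a c) (meet A b d)"
  by (intro le_meet meet_le_mono) auto

lemma join_mono:
  "\<lbrakk>le A a b; le A c d; a \<in> carrier A; b \<in> carrier A; c \<in> carrier A; d \<in> carrier A\<rbrakk>
    \<Longrightarrow> le A (join A a c) (join A b d)"
  by (intro join_le le_join_mono) auto

lemma le_bot: "\<lbrakk>le A a (bot A); a \<in> carrier A\<rbrakk> \<Longrightarrow> a = bot A"
  by (simp add: bot_least le_antisym)

end

section \<open>Implication and pseudocomplement in Heyting algebras\<close>

context heyting_algebra
begin

lemma le_one: "a \<in> carrier A \<Longrightarrow> le A a (one A)"
  unfolding one_def using residuation[of a "bot A" "bot A"] meet_le2[of a "bot A"] by simp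

lemma modus_ponens: "\<lbrakk>a \<in> carrier A; b \<in> carrier A\<rbrakk> \<Longrightarrow> le A (meet A (imp A a b) a) b"
  by (simp add: residuation)

lemma le_imp: "\<lbrakk>a \<in> carrier A; b \<in> carrier A\<rbrakk> \<Longrightarrow> le A b (imp A a b)"
  using residuation[of b a b] meet_le1[of b a] by simp

lemma meet_neg_le: "\<lbrakk>a \<in> carrier A; b \<in> carrier A\<rbrakk> \<Longrightarrow> le A (meet A (neg A a) a) b"
  unfolding neg_def using le_trans[OF modus_ponens[of a "bot A"] bot_least[of b]] by simp

lemma neg_le_imp: "\<lbrakk>a \<in> carrier A; b \<in> carrier A\<rbrakk> \<Longrightarrow> le A (neg A a) (imp A a b)"
  using residuation[of "neg A a" a b] meet_neg_le[of a b] by simp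

lemma le_neg_iff:
  "\<lbrakk>a \<in> carrier A; b \<in> carrier A\<rbrakk> \<Longrightarrow> le A a (neg A b) \<longleftrightarrow> le A (meet A a b) (bot A)"
  by (simp add: neg_def residuation)

lemma le_neg_comm:
  "\<lbrakk>a \<in> carrier A; b \<in> carrier A\<rbrakk> \<Longrightarrow> le A a (neg A b) \<longleftrightarrow> le A b (neg A a)"
  by (simp add: le_neg_iff meet_comm)

lemma neg_antimono:
  "\<lbrakk>le A a b; a \<in> carrier A; b \<in> carrier A\<rbrakk> \<Longrightarrow> le A (neg A b) (neg A a)"
  using le_trans[of a b "neg A (neg A b)"] le_neg_comm[of b "neg A b"] le_neg_comm[of a "neg A b"]
  by simp

lemma le_neg_neg: "a \<in> carrier A \<Longrightarrow> le A a (neg A (neg A a))"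
  using le_neg_comm[of a "neg A a"] by simp

text \<open>Meeting with \<open>c\<close> is left adjoint to \<open>imp A c\<close>, hence preserves
  joins. With its mirror image it lets the simplifier settle distributive inequalities by
  cases.\<close>

lemma join_meet_le_iff:
  assumes "a \<in> carrier A" "b \<in> carrier A" "c \<in> carrier A" "d \<in> carrier A"
  shows "le A (meet A (join A a b) c) d \<longleftrightarrow> le A (meet A a c) d \<and> le A (meet A b c) d"
proof -
  have "le A (join A a b) (imp A c d) \<longleftrightarrow> le A a (imp A c d) \<and> le A b (imp A c d)"
    using assms join_le[of a "imp A c d" b] le_trans[OF le_join1[of a b], of "imp A c d"]
      le_trans[OF le_join2[of a b], of "imp A c d"] by auto
  then show ?thesis
    using assms by (simp add: residuation)
qed

lemma meet_join_le_iff: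
  assumes "a \<in> carrier A" "b \<in> carrier A" "c \<in> carrier A" "d \<in> carrier A"
  shows "le A (meet A c (join A a b)) d \<longleftrightarrow> le A (meet A c a) d \<and> le A (meet A c b) d"
  using join_meet_le_iff[OF assms] assms by (simp add: meet_comm)

text \<open>By residuation it is enough that the meet with \<open>a\<close> is below
  \<open>bot A\<close>, and it lies below both \<open>c\<close> and \<open>neg A c\<close>.\<close>

lemma contrapose_meet:
  assumes "le A (meet A a b) c" "a \<in> carrier A" "b \<in> carrier A" "c \<in> carrier A"
  shows "le A (meet A b (neg A c)) (neg A a)"
proof -
  let ?m = "meet A (meet A b (neg A c)) a"
  have "le A ?m (neg A c)" "le A ?m (meet A a b)"
    using assms by (simp_all add: le_meet meet_le_mono)
  then have "le A ?m (meet A (neg A c) c)"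
    using assms le_trans[of ?m "meet A a b" c] by (simp add: le_meet)
  then have "le A ?m (bot A)"
    using assms le_trans[OF _ meet_neg_le[of c "bot A"]] by simp
  then show ?thesis
    using assms by (simp add: le_neg_iff)
qed

text \<open>The pseudocomplement of the join lies below both \<open>neg A a\<close> and
  \<open>neg A (neg A a)\<close>.\<close>

lemma dense_join_neg:
  assumes "a \<in> carrier A"
  shows "dense A (join A a (neg A a))"
proof -
  let ?n = "neg A (join A a (neg A a))"
  have "le A ?n (neg A a)" "le A ?n (neg A (neg A a))"
    using assms by (simp_all add: neg_antimono le_join1 le_join2)
  then have "le A ?n (meet A (neg A (neg A a)) (neg A a))"
    using assms by (simp add: le_meet)
  then have "le A ?n (bot A)"
    using assms le_trans[OF _ meet_neg_le[of "neg A a" "bot A"]] by simp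
  then show ?thesis
    using assms by (simp add: dense_def le_bot)
qed

end

section \<open>Boolean algebras as Heyting algebras\<close>

context boolean_algebra_on
begin

text \<open>Excluded middle splits \<open>a\<close> into a part below \<open>neg A b\<close> and a
  part below \<open>c\<close>.\<close>

lemma le_join_neg:
  assumes "le A (meet A a b) c" "a \<in> carrier A" "b \<in> carrier A" "c \<in> carrier A"
  shows "le A a (join A (neg A b) c)"
proof -
  have "a = meet A a (join A (neg A b) b)"
    using assms one_greatest[of a] by (simp add: join_neg join_comm[of "neg A b"] le_def)
  also have "\<dots> = join A (meet A a (neg A b)) (meet A a b)"
    using assms by (simp add: distrib)
  finally have "a = join A (meet A a (neg A b)) (meet A a b)" .
  moreover have "le A (join A (meet A a (neg A b)) (meet A a b)) (join A (neg A b) c)"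
    using assms by (simp add: join_mono meet_le2)
  ultimately show ?thesis by simp
qed

lemma boolean_residuation:
  assumes "a \<in> carrier A" "b \<in> carrier A" "c \<in> carrier A"
  shows "le A (meet A a b) c \<longleftrightarrow> le A a (imp A b c)"
proof
  assume "le A (meet A a b) c"
  then show "le A a (imp A b c)"
    using assms by (simp add: imp_eq le_join_neg)
next
  assume "le A a (imp A b c)"
  then have "le A (meet A a b) (meet A b (join A (neg A b) c))"
    using assms by (simp add: imp_eq meet_comm[of a b] meet_mono)
  moreover have "meet A b (join A (neg A b) c) = join A (bot A) (meet A b c)"
    using assms by (simp add: distrib meet_neg)
  moreover have "le A (join A (bot A) (meet A b c)) c"
    using assms by (simp add: join_le bot_least meet_le2)
  ultimately show "le A (meet A a b) c"
    using assms le_trans[of "meet A a b" "join A (bot A) (meet A b c)" c] by simp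
qed

end

text \<open>Closure of twist universes can thus be proved once, for Heyting algebras, and used over
  both \<open>A\<close> and \<open>B\<close>.\<close>

sublocale boolean_algebra_on \<subseteq> heyting_algebra A
  by unfold_locales (rule boolean_residuation)

section \<open>Interior and closure operators\<close>

context topological_boolean_algebra
begin

declare box_closed [simp, intro]

lemma dia_closed [simp, intro]: "a \<in> carrier B \<Longrightarrow> dia B a \<in> carrier B"
  by (simp add: dia_def)

lemma box_box [simp]: "a \<in> carrier B \<Longrightarrow> box B (box B a) = box B a"
  by (simp add: le_antisym box_le box_le_box_box)

lemma box_mono:
  "\<lbrakk>le B a b; a \<in> carrier B; b \<in> carrier B\<rbrakk> \<Longrightarrow> le B (box B a) (box B b)"
  by (metis box_meet le_def)

lemma dia_mono:
  "\<lbrakk>le B a b; a \<in> carrier B; b \<in> carrier B\<rbrakk> \<Longrightarrow> le B (dia B a) (dia B b)"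
  by (simp add: dia_def box_mono neg_antimono)

lemma dia_dia_le: "a \<in> carrier B \<Longrightarrow> le B (dia B (dia B a)) (dia B a)"
  unfolding dia_def
  using box_mono[OF le_neg_neg[of "box B (neg B a)"]] by (simp add: neg_antimono)

text \<open>Box the Boolean inequality \<not>(x \<and> y) \<and> x \<le> \<not>y, then contrapose
  while keeping \<box>x on the left.\<close>

lemma box_meet_dia_le:
  assumes "x \<in> carrier B" "y \<in> carrier B"
  shows "le B (meet B (box B x) (dia B y)) (dia B (meet B x y))"
proof -
  have "le B (meet B (meet B (neg B (meet B x y)) x) y) (bot B)"
    using assms by (simp add: meet_assoc meet_neg_le)
  then have "le B (meet B (neg B (meet B x y)) x) (neg B y)"
    using assms by (simp add: le_neg_iff)
  then have "le B (meet B (box B (neg B (meet B x y))) (box B x)) (box B (neg B y))"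
    using assms box_mono[of "meet B (neg B (meet B x y)) x"] by (simp add: box_meet)
  then show ?thesis
    unfolding dia_def using assms by (intro contrapose_meet) auto
qed

text \<open>Disjunctive syllogism under \<box>.\<close>

lemma box_join_meet_box_neg_le:
  assumes "x \<in> carrier B" "y \<in> carrier B"
  shows "le B (meet B (box B (join B x y)) (box B (neg B y))) (box B x)"
proof -
  have "le B (meet B (join B x y) (neg B y)) x"
    using assms by (simp add: join_meet_le_iff meet_le1 meet_comm[of y] meet_neg_le)
  then show ?thesis
    using assms box_mono[of "meet B (join B x y) (neg B y)"] by (simp add: box_meet)
qed

text \<open>Moving \<box>\<not>y across the inequality turns it into its complement, which is
  \<diamond>y.\<close>

lemma box_join_le_join_dia:
  assumes "x \<in> carrier B" "y \<in> carrier B"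
  shows "le B (box B (join B x y)) (join B (box B x) (dia B y))"
  unfolding dia_def
  using le_join_neg[OF box_join_meet_box_neg_le[OF assms]] assms
    join_comm[of "box B x" "neg B (box B (neg B y))"] by simp

end

section \<open>Twist-structures as subalgebras\<close>

lemma lfilter_up:
  "\<lbrakk>lfilter A F; a \<in> F; le A a b; b \<in> carrier A\<rbrakk> \<Longrightarrow> b \<in> F"
  by (auto simp: lfilter_def)

lemma lfilter_meet: "\<lbrakk>lfilter A F; a \<in> F; b \<in> F\<rbrakk> \<Longrightarrow> meet A a b \<in> F"
  by (auto simp: lfilter_def)

lemma lideal_down:
  "\<lbrakk>lideal A I; a \<in> I; le A b a; b \<in> carrier A\<rbrakk> \<Longrightarrow> b \<in> I"
  by (auto simp: lideal_def)

lemma lideal_join: "\<lbrakk>lideal A I; a \<in> I; b \<in> I\<rbrakk> \<Longrightarrow> join A a b \<in> I"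
  by (auto simp: lideal_def)

lemma Tw_simps [simp]:
  "carrier (Tw C F I) = twist_univ C F I"
  "join (Tw C F I) (a, b) (c, d) = (join C a c, meet C b d)"
  "meet (Tw C F I) (a, b) (c, d) = (meet C a c, join C b d)"
  "imp (Tw C F I) (a, b) (c, d) = (imp C a c, meet C a d)"
  "bot (Tw C F I) = (bot C, one C)"
  "sneg (Tw C F I) (a, b) = (b, a)"
  by (simp_all add: Tw_def full_twist_def)

lemma mTw_simps [simp]:
  "carrier (mTw C F I) = twist_univ C F I"
  "join (mTw C F I) (a, b) (c, d) = (join C a c, meet C b d)"
  "meet (mTw C F I) (a, b) (c, d) = (meet C a c, join C b d)"
  "imp (mTw C F I) (a, b) (c, d) = (imp C a c, meet C a d)"
  "bot (mTw C F I) = (bot C, one C)"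
  "sneg (mTw C F I) (a, b) = (b, a)"
  "mbox (mTw C F I) (a, b) = (box C a, dia C b)"
  "mdia (mTw C F I) (a, b) = (dia C a, box C b)"
  by (simp_all add: mTw_def full_mtwist_def full_twist_def nalg.defs mnalg.defs)

section \<open>Closure of the twist universe under the operations\<close>

context heyting_algebra
begin

lemma one_mem_lfilter: "lfilter A F \<Longrightarrow> one A \<in> F"
  unfolding lfilter_def using le_one one_closed by blast

lemma bot_mem_lideal: "lideal A I \<Longrightarrow> bot A \<in> I"
  unfolding lideal_def using bot_least bot_closed by blast

lemma twist_univ_bot:
  assumes "lfilter A F" "lideal A I"
  shows "(bot A, one A) \<in> twist_univ A F I"
proof -
  have "join A (bot A) (one A) = one A" "meet A (bot A) (one A) = bot A"
    by (simp_all add: bot_least le_iff_join[symmetric] le_def[symmetric])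
  then show ?thesis
    using assms by (simp add: twist_univ_def one_mem_lfilter bot_mem_lideal)
qed

lemma twist_univ_sneg:
  "(a, b) \<in> twist_univ A F I \<Longrightarrow> (b, a) \<in> twist_univ A F I"
  by (simp add: twist_univ_def join_comm meet_comm)

lemma twist_univ_join:
  assumes F: "lfilter A F" and I: "lideal A I"
    and ab: "(a, b) \<in> twist_univ A F I" and cd: "(c, d) \<in> twist_univ A F I"
  shows "(join A a c, meet A b d) \<in> twist_univ A F I"
proof -
  have [simp]: "a \<in> carrier A" "b \<in> carrier A" "c \<in> carrier A" "d \<in> carrier A"
    and mem: "join A a b \<in> F" "join A c d \<in> F" "meet A a b \<in> I" "meet A c d \<in> I"
    using ab cd by (auto simp: twist_univ_def)
  \<comment> \<open>Both defining conditions are inherited: the new join dominates a meet of two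
    elements of \<open>F\<close>, and the new meet lies below a join of two elements of
    \<open>I\<close>.\<close>
  have "le A (meet A (join A a b) (join A c d)) (join A (join A a c) (meet A b d))"
    by (simp add: join_meet_le_iff meet_join_le_iff le_join_mono meet_le_mono)
  moreover have "le A (meet A (join A a c) (meet A b d)) (join A (meet A a b) (meet A c d))"
    by (simp add: join_meet_le_iff le_join_mono meet_mono meet_le1 meet_le2)
  ultimately show ?thesis
    using lfilter_up[OF F lfilter_meet[OF F mem(1,2)]] lideal_down[OF I lideal_join[OF I mem(3,4)]]
    by (simp add: twist_univ_def)
qed

text \<open>De Morgan duality: exchanging components reduces this to
  \<open>twist_univ_join\<close>.\<close>

lemma twist_univ_meet:
  assumes "lfilter A F" "lideal A I" "(a, b) \<in> twist_univ A F I" "(c, d) \<in> twist_univ A F I"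
  shows "(meet A a c, join A b d) \<in> twist_univ A F I"
  by (rule twist_univ_sneg, rule twist_univ_join)
    (rule assms twist_univ_sneg[OF assms(3)] twist_univ_sneg[OF assms(4)])+

text \<open>\<open>em\<close> supplies the case split that a Heyting algebra lacks: \<not>a or c
  gives a \<rightarrow> c, while a together with d gives a \<and> d.\<close>

lemma twist_univ_imp:
  assumes F: "lfilter A F" and I: "lideal A I"
    and em: "join A a (neg A a) \<in> F"
    and ab: "(a, b) \<in> twist_univ A F I" and cd: "(c, d) \<in> twist_univ A F I"
  shows "(imp A a c, meet A a d) \<in> twist_univ A F I"
proof -
  have [simp]: "a \<in> carrier A" "b \<in> carrier A" "c \<in> carrier A" "d \<in> carrier A"
    and mem: "join A c d \<in> F" "meet A c d \<in> I"
    using ab cd by (auto simp: twist_univ_def)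
  have "le A (meet A (join A c d) (join A a (neg A a))) (join A (imp A a c) (meet A a d))"
    by (simp add: join_meet_le_iff meet_join_le_iff le_join_mono meet_le_mono le_imp neg_le_imp
        meet_comm[of d a])
  moreover have "le A (meet A (imp A a c) (meet A a d)) (meet A c d)"
    by (simp add: meet_assoc[symmetric] meet_mono modus_ponens)
  ultimately show ?thesis
    using lfilter_up[OF F lfilter_meet[OF F mem(1) em]] lideal_down[OF I mem(2)]
    by (simp add: twist_univ_def)
qed

text \<open>Double negation is monotone, so the join of two witnesses serves for the join. The
  closure lemmas over \<open>A\<close> require this ideal.\<close>

lemma lideal_N:
  assumes I: "lideal A I"
  shows "lideal A (N A I)"
  unfolding lideal_def
proof (intro conjI ballI impI)
  have sub: "I \<subseteq> carrier A" using I by (simp add: lideal_def)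
  show "N A I \<subseteq> carrier A" by (auto simp: N_def)
  have "le A (bot A) (neg A (neg A (bot A)))"
    by (simp add: bot_least)
  then have "bot A \<in> N A I"
    using bot_mem_lideal[OF I] by (auto simp: N_def)
  then show "N A I \<noteq> {}" by blast
  show "join A a b \<in> N A I" if aN: "a \<in> N A I" and bN: "b \<in> N A I" for a b
  proof -
    obtain c where a: "a \<in> carrier A" "c \<in> I" "le A a (neg A (neg A c))"
      using aN by (auto simp: N_def)
    obtain d where b: "b \<in> carrier A" "d \<in> I" "le A b (neg A (neg A d))"
      using bN by (auto simp: N_def)
    note * = a b
    have cd: "c \<in> carrier A" "d \<in> carrier A" using * sub by auto
    have "le A (neg A (neg A c)) (neg A (neg A (join A c d)))"
      "le A (neg A (neg A d)) (neg A (neg A (join A c d)))"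
      using cd by (simp_all add: neg_antimono le_join1 le_join2)
    then have "le A a (neg A (neg A (join A c d)))" "le A b (neg A (neg A (join A c d)))"
      using * cd le_trans[of a "neg A (neg A c)"] le_trans[of b "neg A (neg A d)"] by simp_all
    then have "le A (join A a b) (neg A (neg A (join A c d)))"
      using * cd by (simp add: join_le)
    then show ?thesis
      using * lideal_join[OF I] by (auto simp: N_def)
  qed
  show "b \<in> N A I" if a: "a \<in> N A I" and b: "b \<in> carrier A" "le A b a" for a b
  proof -
    obtain c where c: "a \<in> carrier A" "c \<in> I" "le A a (neg A (neg A c))"
      using a by (auto simp: N_def)
    then have "le A b (neg A (neg A c))"
      using b sub le_trans[of b a "neg A (neg A c)"] by auto
    then show ?thesis using b c by (auto simp: N_def)
  qed
qed

end

context topological_boolean_algebra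
begin

text \<open>\<box>(x \<or> y) \<le> \<box>x \<or> \<diamond>y and \<box>x \<and> \<diamond>y \<le>
  \<diamond>(x \<and> y), so a filter stable under \<box> and an ideal stable under \<diamond>
  suffice.\<close>

lemma twist_univ_box:
  assumes F: "lfilter B F" and I: "lideal B I"
    and box_F: "\<And>x. x \<in> F \<Longrightarrow> box B x \<in> F" and dia_I: "\<And>x. x \<in> I \<Longrightarrow> dia B x \<in> I"
    and xy: "(x, y) \<in> twist_univ B F I"
  shows "(box B x, dia B y) \<in> twist_univ B F I"
  using xy lfilter_up[OF F box_F box_join_le_join_dia[of x y]]
    lideal_down[OF I dia_I box_meet_dia_le[of x y]]
  by (simp add: twist_univ_def)

end

section \<open>Valuations\<close>

text \<open>Validity quantifies over homomorphisms on all formulas; this is the one determined by an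
  assignment to the variables.\<close>

primrec eval_fm :: "('a, 'm) nalg_scheme \<Rightarrow> ('p \<Rightarrow> 'a) \<Rightarrow> 'p fm \<Rightarrow> 'a" where
  "eval_fm T g (Var p) = g p"
| "eval_fm T g Bot = bot T"
| "eval_fm T g (And \<phi> \<psi>) = meet T (eval_fm T g \<phi>) (eval_fm T g \<psi>)"
| "eval_fm T g (Or \<phi> \<psi>) = join T (eval_fm T g \<phi>) (eval_fm T g \<psi>)"
| "eval_fm T g (Imp \<phi> \<psi>) = imp T (eval_fm T g \<phi>) (eval_fm T g \<psi>)"
| "eval_fm T g (SNeg \<phi>) = sneg T (eval_fm T g \<phi>)"

primrec eval_mfm :: "('a, 'm) mnalg_scheme \<Rightarrow> ('p \<Rightarrow> 'a) \<Rightarrow> 'p mfm \<Rightarrow> 'a" where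
  "eval_mfm T g (MVar p) = g p"
| "eval_mfm T g MBot = bot T"
| "eval_mfm T g (MAnd \<phi> \<psi>) = meet T (eval_mfm T g \<phi>) (eval_mfm T g \<psi>)"
| "eval_mfm T g (MOr \<phi> \<psi>) = join T (eval_mfm T g \<phi>) (eval_mfm T g \<psi>)"
| "eval_mfm T g (MImp \<phi> \<psi>) = imp T (eval_mfm T g \<phi>) (eval_mfm T g \<psi>)"
| "eval_mfm T g (MSNeg \<phi>) = sneg T (eval_mfm T g \<phi>)"
| "eval_mfm T g (MBox \<phi>) = mbox T (eval_mfm T g \<phi>)"
| "eval_mfm T g (MDia \<phi>) = mdia T (eval_mfm T g \<phi>)"

lemma (in heyting_algebra) fm_hom_eval_fm:
  assumes F: "lfilter A F" and I: "lideal A I"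
    and em: "\<And>a. a \<in> carrier A \<Longrightarrow> join A a (neg A a) \<in> F"
    and g: "\<And>p. g p \<in> twist_univ A F I"
  shows "fm_hom (eval_fm (Tw A F I) g) (Tw A F I)"
proof -
  have "eval_fm (Tw A F I) g \<phi> \<in> twist_univ A F I" for \<phi>
  proof (induction \<phi>)
    case (Imp \<phi> \<psi>)
    moreover have "fst (eval_fm (Tw A F I) g \<phi>) \<in> carrier A"
      using Imp.IH(1) by (auto simp: twist_univ_def)
    ultimately show ?case
      by (cases "eval_fm (Tw A F I) g \<phi>"; cases "eval_fm (Tw A F I) g \<psi>")
        (auto intro: twist_univ_imp[OF F I em])
  next
    case (And \<phi> \<psi>)
    then show ?case
      by (cases "eval_fm (Tw A F I) g \<phi>"; cases "eval_fm (Tw A F I) g \<psi>")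
        (auto intro: twist_univ_meet[OF F I])
  next
    case (Or \<phi> \<psi>)
    then show ?case
      by (cases "eval_fm (Tw A F I) g \<phi>"; cases "eval_fm (Tw A F I) g \<psi>")
        (auto intro: twist_univ_join[OF F I])
  next
    case (SNeg \<phi>)
    then show ?case
      by (cases "eval_fm (Tw A F I) g \<phi>") (auto dest: twist_univ_sneg)
  qed (simp_all add: g twist_univ_bot[OF F I])
  then show ?thesis by (simp add: fm_hom_def)
qed

lemma (in topological_boolean_algebra) mfm_hom_eval_mfm:
  assumes F: "lfilter B F" and I: "lideal B I"
    and box_F: "\<And>x. x \<in> F \<Longrightarrow> box B x \<in> F" and dia_I: "\<And>x. x \<in> I \<Longrightarrow> dia B x \<in> I"
    and g: "\<And>p. g p \<in> twist_univ B F I"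
  shows "mfm_hom (eval_mfm (mTw B F I) g) (mTw B F I)"
proof -
  \<comment> \<open>In \<open>B\<close> excluded middle is \<open>one B\<close> itself, which lies
    in every filter.\<close>
  have em: "join B a (neg B a) \<in> F" if "a \<in> carrier B" for a
    using that one_mem_lfilter[OF F] by (simp add: join_neg)
  have "eval_mfm (mTw B F I) g \<phi> \<in> twist_univ B F I" for \<phi>
  proof (induction \<phi>)
    case (MImp \<phi> \<psi>)
    moreover have "fst (eval_mfm (mTw B F I) g \<phi>) \<in> carrier B"
      using MImp.IH(1) by (auto simp: twist_univ_def)
    ultimately show ?case
      by (cases "eval_mfm (mTw B F I) g \<phi>"; cases "eval_mfm (mTw B F I) g \<psi>")
        (auto intro: twist_univ_imp[OF F I em])
  next
    case (MAnd \<phi> \<psi>)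
    then show ?case
      by (cases "eval_mfm (mTw B F I) g \<phi>"; cases "eval_mfm (mTw B F I) g \<psi>")
        (auto intro: twist_univ_meet[OF F I])
  next
    case (MOr \<phi> \<psi>)
    then show ?case
      by (cases "eval_mfm (mTw B F I) g \<phi>"; cases "eval_mfm (mTw B F I) g \<psi>")
        (auto intro: twist_univ_join[OF F I])
  next
    case (MSNeg \<phi>)
    then show ?case
      by (cases "eval_mfm (mTw B F I) g \<phi>") (auto dest: twist_univ_sneg)
  next
    case (MBox \<phi>)
    then show ?case
      by (cases "eval_mfm (mTw B F I) g \<phi>") (auto intro: twist_univ_box[OF F I box_F dia_I])
  next
    \<comment> \<open>\<diamond> is \<box> conjugated by the exchange of components.\<close>
    case (MDia \<phi>)
    then show ?case
      by (cases "eval_mfm (mTw B F I) g \<phi>")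
        (auto intro: twist_univ_sneg[OF twist_univ_box[OF F I box_F dia_I twist_univ_sneg]])
  qed (simp_all add: g twist_univ_bot[OF F I])
  then show ?thesis by (simp add: mfm_hom_def)
qed

section \<open>A Heyting algebra as the open elements\<close>

text \<open>Holds only the identification of \<open>A\<close> with the open elements; generation of
  \<open>B\<close> by them enters as the separate hypothesis \<open>gen\<close>.\<close>

locale open_embedding =
  A: heyting_algebra A + B: topological_boolean_algebra B
  for A :: "('a, 'm) halg_scheme" and B :: "('b, 'n) talg_scheme" +
  fixes e :: "'a \<Rightarrow> 'b"
  assumes iso: "halg_iso e A (open_algebra B)"
begin

lemma e_image: "e ` carrier A = {x \<in> carrier B. box B x = x}"
  using iso by (auto simp: halg_iso_def open_algebra_def bij_betw_def)

lemma e_inj: "inj_on e (carrier A)"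
  using iso by (simp add: halg_iso_def bij_betw_def)

lemma e_closed [simp, intro]: "a \<in> carrier A \<Longrightarrow> e a \<in> carrier B"
  and box_e [simp]: "a \<in> carrier A \<Longrightarrow> box B (e a) = e a"
  using e_image by blast+

lemma box_in_image:
  assumes "x \<in> carrier B"
  obtains a where "a \<in> carrier A" "box B x = e a"
proof -
  have "box B x \<in> e ` carrier A" using assms by (simp add: e_image)
  then show thesis using that by blast
qed

lemma e_join: "\<lbrakk>a \<in> carrier A; b \<in> carrier A\<rbrakk> \<Longrightarrow> e (join A a b) = join B (e a) (e b)"
  and e_meet: "\<lbrakk>a \<in> carrier A; b \<in> carrier A\<rbrakk> \<Longrightarrow> e (meet A a b) = meet B (e a) (e b)"
  and e_imp: "\<lbrakk>a \<in> carrier A; b \<in> carrier A\<rbrakk> \<Longrightarrow> e (imp A a b) = box B (imp B (e a) (e b))"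
  and e_bot: "e (bot A) = bot B"
  using iso by (simp_all add: halg_iso_def open_algebra_def)

lemma e_one: "e (one A) = one B"
  unfolding one_def using B.box_one by (simp add: e_imp e_bot one_def)

lemma e_neg: "a \<in> carrier A \<Longrightarrow> e (neg A a) = box B (neg B (e a))"
  by (simp add: neg_def e_imp e_bot)

text \<open>Negation in \<open>A\<close> is the interior of Boolean negation, and
  \<box>\<not>\<box>\<not> is \<box>\<diamond>. This links \<open>N\<close> with
  \<open>sigma\<close>.\<close>

lemma e_neg_neg: "a \<in> carrier A \<Longrightarrow> e (neg A (neg A a)) = box B (dia B (e a))"
  by (simp add: e_neg dia_def)

lemma e_eq_iff: "\<lbrakk>a \<in> carrier A; b \<in> carrier A\<rbrakk> \<Longrightarrow> e a = e b \<longleftrightarrow> a = b"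
  using e_inj by (simp add: inj_on_eq_iff)

lemma e_le_iff: "\<lbrakk>a \<in> carrier A; b \<in> carrier A\<rbrakk> \<Longrightarrow> le B (e a) (e b) \<longleftrightarrow> le A a b"
  by (simp add: le_def e_meet[symmetric] e_eq_iff)

lemma e_mem_image_iff:
  "\<lbrakk>X \<subseteq> carrier A; a \<in> carrier A\<rbrakk> \<Longrightarrow> e a \<in> e ` X \<longleftrightarrow> a \<in> X"
  using e_inj by (auto simp: inj_on_image_mem_iff)

section \<open>Transfer of filters and ideals from \<open>A\<close> to \<open>B\<close>\<close>

lemma lfilter_rho:
  assumes F: "lfilter A F"
  shows "lfilter B (rho B (e ` F))"
  unfolding lfilter_def
proof (intro conjI ballI impI)
  have sub: "F \<subseteq> carrier A" using F by (simp add: lfilter_def)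
  show "rho B (e ` F) \<subseteq> carrier B" by (auto simp: rho_def)
  have "one B \<in> rho B (e ` F)"
    using A.one_mem_lfilter[OF F] by (simp add: rho_def B.box_one e_one[symmetric])
  then show "rho B (e ` F) \<noteq> {}" by blast
  show "meet B x y \<in> rho B (e ` F)" if xy: "x \<in> rho B (e ` F)" "y \<in> rho B (e ` F)" for x y
  proof -
    obtain a b where *: "a \<in> F" "b \<in> F" "box B x = e a" "box B y = e b"
      and c: "x \<in> carrier B" "y \<in> carrier B"
      using xy by (auto simp: rho_def)
    then have "box B (meet B x y) = e (meet A a b)"
      using sub by (simp add: B.box_meet e_meet subset_iff)
    then show ?thesis
      using * c lfilter_meet[OF F] by (simp add: rho_def)
  qed
  show "y \<in> rho B (e ` F)"
    if x: "x \<in> rho B (e ` F)" and y: "y \<in> carrier B" and le: "le B x y" for x y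
  proof -
    obtain a where a: "a \<in> F" "box B x = e a" and c: "x \<in> carrier B"
      using x by (auto simp: rho_def)
    obtain b where b: "b \<in> carrier A" "box B y = e b"
      using box_in_image[OF y] .
    \<comment> \<open>Both interiors are images under \<open>e\<close>, so the order is reflected to
      \<open>A\<close>, where \<open>F\<close> is upward closed.\<close>
    have "le A a b"
      using B.box_mono[OF le c y] a b sub e_le_iff by auto
    then show ?thesis
      using lfilter_up[OF F a(1)] b y by (simp add: rho_def)
  qed
qed

lemma box_mem_rho: "x \<in> rho B (e ` F) \<Longrightarrow> box B x \<in> rho B (e ` F)"
  by (simp add: rho_def)

lemma lideal_sigma:
  assumes I: "lideal A I"
  shows "lideal B (sigma B (e ` I))"
  unfolding lideal_def
proof (intro conjI ballI impI)
  have sub: "I \<subseteq> carrier A" using I by (simp add: lideal_def)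
  show "sigma B (e ` I) \<subseteq> carrier B" by (auto simp: sigma_def)
  have "le B (bot B) (dia B (e (bot A)))"
    by (simp add: B.bot_least)
  then have "bot B \<in> sigma B (e ` I)"
    using A.bot_mem_lideal[OF I] by (auto simp: sigma_def)
  then show "sigma B (e ` I) \<noteq> {}" by blast
  show "join B x y \<in> sigma B (e ` I)"
    if xy: "x \<in> sigma B (e ` I)" "y \<in> sigma B (e ` I)" for x y
  proof -
    obtain a b where *: "a \<in> I" "b \<in> I" "le B x (dia B (e a))" "le B y (dia B (e b))"
      and c: "x \<in> carrier B" "y \<in> carrier B"
      using xy by (auto simp: sigma_def)
    then have ab: "a \<in> carrier A" "b \<in> carrier A" using sub by auto
    have "le B (dia B (e a)) (dia B (e (join A a b)))" "le B (dia B (e b)) (dia B (e (join A a b)))"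
      using ab by (simp_all add: B.dia_mono e_le_iff A.le_join1 A.le_join2)
    then have "le B x (dia B (e (join A a b)))" "le B y (dia B (e (join A a b)))"
      using * ab c B.le_trans[of x "dia B (e a)"] B.le_trans[of y "dia B (e b)"] by simp_all
    then have "le B (join B x y) (dia B (e (join A a b)))"
      using ab c by (simp add: B.join_le)
    then show ?thesis
      using * c lideal_join[OF I] by (auto simp: sigma_def)
  qed
  show "y \<in> sigma B (e ` I)"
    if x: "x \<in> sigma B (e ` I)" and y: "y \<in> carrier B" "le B y x" for x y
  proof -
    obtain a where a: "x \<in> carrier B" "a \<in> I" "le B x (dia B (e a))"
      using x by (auto simp: sigma_def)
    then have "le B y (dia B (e a))"
      using y sub B.le_trans[of y x "dia B (e a)"] by auto
    then show ?thesis using y a by (auto simp: sigma_def)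
  qed
qed

text \<open>The same witness works, since \<diamond>\<diamond> \<le> \<diamond>.\<close>

lemma dia_mem_sigma:
  assumes "I \<subseteq> carrier A" "x \<in> sigma B (e ` I)"
  shows "dia B x \<in> sigma B (e ` I)"
proof -
  obtain a where a: "a \<in> I" "le B x (dia B (e a))" and x: "x \<in> carrier B"
    using assms(2) by (auto simp: sigma_def)
  have ea: "e a \<in> carrier B" using a assms(1) by blast
  have "le B (dia B x) (dia B (e a))"
    using B.dia_mono[OF a(2) x] B.dia_dia_le[OF ea] x ea
      B.le_trans[of "dia B x" "dia B (dia B (e a))" "dia B (e a)"] by simp
  then show ?thesis
    using a x by (auto simp: sigma_def)
qed

section \<open>Transfer of pairs between the two twist universes\<close>

lemma twist_univ_e:
  assumes F: "lfilter A F" and I: "lideal A I" and ab: "(a, b) \<in> twist_univ A F (N A I)"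
  shows "(e a, e b) \<in> twist_univ B (rho B (e ` F)) (sigma B (e ` I))"
proof -
  have c [simp]: "a \<in> carrier A" "b \<in> carrier A" and F': "join A a b \<in> F"
    using ab by (auto simp: twist_univ_def)
  obtain d where d: "d \<in> I" "le A (meet A a b) (neg A (neg A d))"
    using ab by (auto simp: twist_univ_def N_def)
  have dc [simp]: "d \<in> carrier A" using d I by (auto simp: lideal_def)
  have "le B (meet B (e a) (e b)) (box B (dia B (e d)))"
    using d(2) e_le_iff[of "meet A a b" "neg A (neg A d)"] by (simp add: e_meet e_neg_neg)
  then have "le B (meet B (e a) (e b)) (dia B (e d))"
    using B.le_trans[OF _ B.box_le[of "dia B (e d)"]] by simp
  then show ?thesis
    using d F' by (auto simp: twist_univ_def rho_def sigma_def e_join[symmetric])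
qed

text \<open>Induction over the generation of \<open>B\<close>. Working with the filter
  \<open>rho\<close> of \<open>B\<close> instead of \<open>F\<close> avoids preimages under
  \<open>e\<close> in the Boolean closure steps.\<close>

lemma box_join_box_neg_mem:
  assumes F: "lfilter A F" and dense: "\<And>a. dense A a \<Longrightarrow> a \<in> F"
    and gen: "generated_by B (carrier (open_algebra B))"
    and x: "x \<in> carrier B"
  shows "join B (box B x) (box B (neg B x)) \<in> rho B (e ` F)"
proof -
  note R = lfilter_rho[OF F]
  define d where "d y = join B (box B y) (box B (neg B y))" for y
  define S where "S = {y \<in> carrier B. d y \<in> rho B (e ` F)}"
  \<comment> \<open>Membership in \<open>S\<close> is shown below by bounding \<open>d y\<close>
    from below with an element of the filter.\<close>
  have up: "y \<in> S" if "z \<in> rho B (e ` F)" "le B z (d y)" "y \<in> carrier B" for y z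
    using that lfilter_up[OF R] by (simp add: S_def d_def)
  have d_closed [simp]: "d y \<in> carrier B" if "y \<in> carrier B" for y
    using that by (simp add: d_def)
  have open_S: "e a \<in> S" if a: "a \<in> carrier A" for a
  proof -
    \<comment> \<open>\<open>e a\<close> is open and the interior of its complement is the image of
      \<open>neg A a\<close>, so \<open>d\<close> yields the image of a dense element.\<close>
    have "d (e a) = e (join A a (neg A a))"
      using a by (simp add: d_def e_join e_neg)
    then show ?thesis
      using dense[OF A.dense_join_neg[OF a]] a by (simp add: S_def rho_def)
  qed
  have sub_S: "carrier (open_algebra B) \<subseteq> S"
    using open_S by (simp add: open_algebra_def e_image[symmetric] image_subset_iff)
  have neg_S: "neg B y \<in> S" if y: "y \<in> S" for y
  proof (rule up)
    show "d y \<in> rho B (e ` F)" "neg B y \<in> carrier B" using y by (auto simp: S_def)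
    have yc: "y \<in> carrier B" using y by (simp add: S_def)
    show "le B (d y) (d (neg B y))"
      unfolding d_def using yc
      by (simp add: B.join_le B.le_join_mono B.box_mono B.le_neg_neg)
  qed
  have join_S: "join B y z \<in> S" if y: "y \<in> S" and z: "z \<in> S" for y z
  proof (rule up)
    have [simp]: "y \<in> carrier B" "z \<in> carrier B" using y z by (auto simp: S_def)
    show "meet B (d y) (d z) \<in> rho B (e ` F)"
      using y z lfilter_meet[OF R] by (simp add: S_def)
    show "join B y z \<in> carrier B" by simp
    \<comment> \<open>Cases: \<box>y or \<box>z gives \<box>(y \<or> z); otherwise \<box>\<not>y and
      \<box>\<not>z hold, and De Morgan gives \<box>\<not>(y \<or> z).\<close>
    have "le B (box B y) (box B (join B y z))" "le B (box B z) (box B (join B y z))"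
      by (simp_all add: B.box_mono B.le_join1 B.le_join2)
    moreover have "le B (meet B (neg B y) (neg B z)) (neg B (join B y z))"
    proof -
      have "le B y (neg B (meet B (neg B y) (neg B z)))" "le B z (neg B (meet B (neg B y) (neg B z)))"
        by (simp_all add: B.le_neg_comm[of _ "meet B _ _"] B.meet_le1 B.meet_le2)
      then show ?thesis
        by (simp add: B.le_neg_comm[of "meet B _ _"] B.join_le)
    qed
    then have "le B (meet B (box B (neg B y)) (box B (neg B z))) (box B (neg B (join B y z)))"
      by (simp add: B.box_meet[symmetric] B.box_mono)
    ultimately show "le B (meet B (d y) (d z)) (d (join B y z))"
      unfolding d_def
      by (simp add: B.join_meet_le_iff B.meet_join_le_iff B.le_join_mono B.meet_le_mono)
  qed
  have meet_S: "meet B y z \<in> S" if y: "y \<in> S" and z: "z \<in> S" for y z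
  proof (rule up)
    have [simp]: "y \<in> carrier B" "z \<in> carrier B" using y z by (auto simp: S_def)
    show "meet B (d y) (d z) \<in> rho B (e ` F)"
      using y z lfilter_meet[OF R] by (simp add: S_def)
    show "meet B y z \<in> carrier B" by simp
    \<comment> \<open>Dual cases: \<box>y and \<box>z together give \<box>(y \<and> z), while
      \<box>\<not>y or \<box>\<not>z refutes the meet.\<close>
    have "le B (meet B (box B y) (box B z)) (box B (meet B y z))"
      by (simp add: B.box_meet)
    moreover have "le B (box B (neg B y)) (box B (neg B (meet B y z)))"
      "le B (box B (neg B z)) (box B (neg B (meet B y z)))"
      by (simp_all add: B.box_mono B.neg_antimono B.meet_le1 B.meet_le2)
    ultimately show "le B (meet B (d y) (d z)) (d (meet B y z))"
      unfolding d_def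
      by (simp add: B.join_meet_le_iff B.meet_join_le_iff B.le_join_mono B.meet_le_mono)
  qed
  have "subuniverse B S"
    unfolding subuniverse_def
  proof (intro conjI ballI)
    show "S \<subseteq> carrier B" by (auto simp: S_def)
    show "bot B \<in> S" using open_S[of "bot A"] by (simp add: e_bot)
    fix y assume y: "y \<in> S"
    then have yc: "y \<in> carrier B" by (simp add: S_def)
    \<comment> \<open>\<box>y is itself an image under \<open>e\<close>, so the open case
      applies.\<close>
    show "box B y \<in> S" using box_in_image[OF yc] open_S by metis
    fix z assume z: "z \<in> S"
    then have zc: "z \<in> carrier B" by (simp add: S_def)
    show "join B y z \<in> S" "meet B y z \<in> S" using y z by (simp_all add: join_S meet_S)
    show "imp B y z \<in> S" using y z yc zc by (simp add: B.imp_eq join_S neg_S)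
  qed
  then have "S = carrier B"
    using gen sub_S by (simp add: generated_by_def)
  then show ?thesis using x by (auto simp: S_def d_def)
qed

lemma twist_univ_box_preimage:
  assumes F: "lfilter A F" and dense: "\<And>a. dense A a \<Longrightarrow> a \<in> F" and I: "lideal A I"
    and gen: "generated_by B (carrier (open_algebra B))"
    and xy: "(x, y) \<in> twist_univ B (rho B (e ` F)) (sigma B (e ` I))"
    and a: "a \<in> carrier A" "e a = box B x" and b: "b \<in> carrier A" "e b = box B y"
  shows "(a, b) \<in> twist_univ A F (N A I)"
proof -
  note R = lfilter_rho[OF F]
  have c [simp]: "x \<in> carrier B" "y \<in> carrier B" and xF: "join B x y \<in> rho B (e ` F)"
    using xy by (auto simp: twist_univ_def)
  obtain d where d: "d \<in> I" "le B (meet B x y) (dia B (e d))"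
    using xy by (auto simp: twist_univ_def sigma_def)
  have dc [simp]: "d \<in> carrier A" using d I by (auto simp: lideal_def)
  \<comment> \<open>Passing to interiors turns the bound \<diamond> into \<box>\<diamond>, the image
    of a double negation; this is why \<open>N A I\<close> appears over \<open>A\<close>.\<close>
  have "le B (box B (meet B x y)) (box B (dia B (e d)))"
    using d(2) by (simp add: B.box_mono)
  then have "le B (e (meet A a b)) (e (neg A (neg A d)))"
    using a b by (simp add: e_meet e_neg_neg B.box_meet)
  then have "meet A a b \<in> N A I"
    using d(1) a b by (auto simp: N_def e_le_iff)
  moreover have "join A a b \<in> F"
  proof -
    have "meet B (box B (join B x y)) (join B (box B x) (box B (neg B x))) \<in> rho B (e ` F)"
      using lfilter_meet[OF R box_mem_rho[OF xF] box_join_box_neg_mem[OF F dense gen c(1)]] .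
    \<comment> \<open>Below \<box>(x \<or> y), the case \<box>x is immediate and the case
      \<box>\<not>x forces \<box>y.\<close>
    moreover have
      "le B (meet B (box B (join B x y)) (join B (box B x) (box B (neg B x))))
        (join B (box B x) (box B y))"
      using B.box_join_meet_box_neg_le[of y x]
      by (simp add: B.meet_join_le_iff B.le_join_mono B.meet_le_mono B.join_comm[of y x])
    ultimately have "join B (box B x) (box B y) \<in> rho B (e ` F)"
      using lfilter_up[OF R] by simp
    \<comment> \<open>This join of interiors is the image of \<open>join A a b\<close>, hence its
      own interior, so \<open>rho\<close> gives membership in the image of \<open>F\<close>.\<close>
    then have "e (join A a b) \<in> e ` F"
      using a b box_e[of "join A a b"] by (simp add: rho_def e_join)
    then show ?thesis
      using e_mem_image_iff[of F] F a b by (simp add: lfilter_def)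
  qed
  ultimately show ?thesis using a b by (simp add: twist_univ_def)
qed

text \<open>The second components of \<open>v (TB \<phi>)\<close> and \<open>w \<phi>\<close> need not correspond; the induction uses
  the translation of \<open>SNeg \<phi>\<close> in their place.\<close>

lemma fst_TB:
  assumes v: "mfm_hom v (mTw B F' I')" and w: "fm_hom w (Tw A F I)"
    and var: "\<And>p. e (fst (w (Var p))) = box B (fst (v (MVar p)))"
      "\<And>p. e (snd (w (Var p))) = box B (snd (v (MVar p)))"
  shows "fst (v (TB \<phi>)) = e (fst (w \<phi>)) \<and> fst (v (TB (SNeg \<phi>))) = e (snd (w \<phi>))"
proof -
  have v_simps: "v MBot = (bot B, one B)"
    "fst (v (MAnd \<alpha> \<beta>)) = meet B (fst (v \<alpha>)) (fst (v \<beta>))"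
    "fst (v (MOr \<alpha> \<beta>)) = join B (fst (v \<alpha>)) (fst (v \<beta>))"
    "fst (v (MImp \<alpha> \<beta>)) = imp B (fst (v \<alpha>)) (fst (v \<beta>))"
    "fst (v (MSNeg \<alpha>)) = snd (v \<alpha>)"
    "fst (v (MBox \<alpha>)) = box B (fst (v \<alpha>))" for \<alpha> \<beta>
    using v by (cases "v \<alpha>"; cases "v \<beta>"; simp add: mfm_hom_def)+
  have w_simps: "w Bot = (bot A, one A)"
    "w (And \<alpha> \<beta>) = (meet A (fst (w \<alpha>)) (fst (w \<beta>)), join A (snd (w \<alpha>)) (snd (w \<beta>)))"
    "w (Or \<alpha> \<beta>) = (join A (fst (w \<alpha>)) (fst (w \<beta>)), meet A (snd (w \<alpha>)) (snd (w \<beta>)))"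
    "w (Imp \<alpha> \<beta>) = (imp A (fst (w \<alpha>)) (fst (w \<beta>)), meet A (fst (w \<alpha>)) (snd (w \<beta>)))"
    "w (SNeg \<alpha>) = (snd (w \<alpha>), fst (w \<alpha>))" for \<alpha> \<beta>
    using w by (cases "w \<alpha>"; cases "w \<beta>"; simp add: fm_hom_def)+
  have w_closed: "fst (w \<alpha>) \<in> carrier A" "snd (w \<alpha>) \<in> carrier A" for \<alpha>
  proof -
    have "w \<alpha> \<in> twist_univ A F I" using w by (simp add: fm_hom_def)
    then show "fst (w \<alpha>) \<in> carrier A" "snd (w \<alpha>) \<in> carrier A"
      by (auto simp: twist_univ_def)
  qed
  \<comment> \<open>Structural induction suffices: the paired hypotheses for immediate subformulas
    cover every recursive call of \<open>TB\<close>, including those on negated subformulas.\<close>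
  show ?thesis
    by (induction \<phi>)
      (simp_all add: v_simps w_simps w_closed var e_join e_meet e_imp e_bot e_one)
qed

end

section \<open>Equivalence of validity over \<open>A\<close> and over \<open>B\<close>\<close>

theorem theorem3p3p2:
  fixes A :: "'a halg" and B :: "'b talg" and e :: "'a \<Rightarrow> 'b"
    and F :: "'a set" and I :: "'a set"
  assumes "heyting_algebra A"
    and "is_s A e B"
    and "lfilter A F"
    and "\<And>a. dense A a \<Longrightarrow> a \<in> F"
    and "lideal A I"
  shows "\<forall>\<phi> :: 'p fm.
    mvalid B (mTw B (rho B (e ` F)) (sigma B (e ` I))) (TB \<phi>)
      \<longleftrightarrow> valid A (Tw A F (N A I)) \<phi>"
proof
  fix \<phi> :: "'p fm"
  note F = assms(3) and dense = assms(4) and I = assms(5)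
  have gen: "generated_by B (carrier (open_algebra B))"
    using assms(2) by (simp add: is_s_def)
  interpret open_embedding A B e
    using assms(1,2) by (simp add: open_embedding_def open_embedding_axioms_def is_s_def)
  let ?F = "rho B (e ` F)" and ?I = "sigma B (e ` I)"
  show "mvalid B (mTw B ?F ?I) (TB \<phi>) \<longleftrightarrow> valid A (Tw A F (N A I)) \<phi>"
  proof
    assume val: "mvalid B (mTw B ?F ?I) (TB \<phi>)"
    show "valid A (Tw A F (N A I)) \<phi>"
      unfolding valid_def
    proof (intro allI impI)
      fix w :: "'p fm \<Rightarrow> 'a \<times> 'a"
      assume w: "fm_hom w (Tw A F (N A I))"
      \<comment> \<open>The transported values are open, so the \<box> in the translation of a
        literal leaves them unchanged, as \<open>fst_TB\<close> requires.\<close>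
      define g where "g p = map_prod e e (w (Var p))" for p
      define v where "v = eval_mfm (mTw B ?F ?I) g"
      have mem: "w \<alpha> \<in> twist_univ A F (N A I)" for \<alpha>
        using w by (simp add: fm_hom_def)
      have closed: "fst (w \<alpha>) \<in> carrier A" "snd (w \<alpha>) \<in> carrier A" for \<alpha>
        using mem[of \<alpha>] by (auto simp: twist_univ_def)
      have "g p \<in> twist_univ B ?F ?I" for p
        using twist_univ_e[OF F I, of "fst (w (Var p))" "snd (w (Var p))"] mem[of "Var p"]
        by (simp add: g_def map_prod_def case_prod_unfold)
      moreover have "I \<subseteq> carrier A" using I by (simp add: lideal_def)
      ultimately have v: "mfm_hom v (mTw B ?F ?I)"
        unfolding v_def
        by (intro B.mfm_hom_eval_mfm lfilter_rho[OF F] lideal_sigma[OF I] box_mem_rho dia_mem_sigma)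
      have "fst (v (TB \<phi>)) = e (fst (w \<phi>))"
        using fst_TB[OF v w] closed by (simp add: v_def g_def)
      moreover have "fst (v (TB \<phi>)) = one B"
        using val v by (simp add: mvalid_def)
      ultimately have "e (fst (w \<phi>)) = e (one A)"
        by (simp add: e_one)
      then show "fst (w \<phi>) = one A"
        using closed by (simp add: e_eq_iff)
    qed
  next
    assume val: "valid A (Tw A F (N A I)) \<phi>"
    show "mvalid B (mTw B ?F ?I) (TB \<phi>)"
      unfolding mvalid_def
    proof (intro allI impI)
      fix v :: "'p mfm \<Rightarrow> 'b \<times> 'b"
      assume v: "mfm_hom v (mTw B ?F ?I)"
      have mem: "v \<alpha> \<in> twist_univ B ?F ?I" for \<alpha>
        using v by (simp add: mfm_hom_def)
      have closed: "fst (v \<alpha>) \<in> carrier B" "snd (v \<alpha>) \<in> carrier B" for \<alpha>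
        using mem[of \<alpha>] by (auto simp: twist_univ_def)
      \<comment> \<open>\<open>h x\<close> is the element of \<open>A\<close> identified with
        \<box>x; it exists because interiors are open.\<close>
      define h where "h x = inv_into (carrier A) e (box B x)" for x
      have h: "h x \<in> carrier A" "e (h x) = box B x" if "x \<in> carrier B" for x
      proof -
        have "box B x \<in> e ` carrier A" using that by (simp add: e_image)
        then show "h x \<in> carrier A" "e (h x) = box B x"
          by (simp_all add: h_def inv_into_into f_inv_into_f)
      qed
      define g where "g p = map_prod h h (v (MVar p))" for p
      define w where "w = eval_fm (Tw A F (N A I)) g"
      have "g p \<in> twist_univ A F (N A I)" for p
        using twist_univ_box_preimage[OF F dense I gen,
            of "fst (v (MVar p))" "snd (v (MVar p))" "h (fst (v (MVar p)))" "h (snd (v (MVar p)))"]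
          mem[of "MVar p"] closed[of "MVar p"] h
        by (simp add: g_def map_prod_def case_prod_unfold)
      \<comment> \<open>The density hypothesis supplies the excluded middle that closure under
        implication needs.\<close>
      then have w: "fm_hom w (Tw A F (N A I))"
        unfolding w_def
        by (intro A.fm_hom_eval_fm F A.lideal_N[OF I] dense A.dense_join_neg)
      have "fst (v (TB \<phi>)) = e (fst (w \<phi>))"
        using fst_TB[OF v w] closed h by (simp add: w_def g_def)
      then show "fst (v (TB \<phi>)) = one B"
        using val w by (simp add: valid_def e_one)
    qed
  qed
qed

end
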